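(* Let $A\in\mathbb{R}^{n\times n}$, $B\in\mathbb{R}^{n\times m}$ with $(A,B)$ controllable. Let $u_d(0),\dots,u_d(T-1)\in\mathbb{R}^m$, $x_d(0),\dots,x_d(T)\in\mathbb{R}^n$ satisfy $x_d(k+1)=Ax_d(k)+Bu_d(k)$ for $k=0,\dots,T-1$, and let $w_d(0),\dots,w_d(T)\in\mathbb{R}^n$ be arbitrary (measurement noise). Let $U_{0,1,T}, Z_{0,T}, Z_{1,T}, R_{0,T}$ be the matrices defined in the context. Suppose that: (1) the matrices $\begin{bmatrix}U_{0,1,T}\\ Z_{0,T}\end{bmatrix}$ and $Z_{1,T}$ have full row rank; (2) $R_{0,T}R_{0,T}^\top\preceq\gamma\, Z_{1,T}Z_{1,T}^\top$ for some $\gamma>0$. Then any solution $(Q,\alpha)$, $Q\in\mathbb{R}^{T\times n}$, $\alpha>0$, to $$\begin{bmatrix}Z_{0,T}Q-\alpha Z_{1,T}Z_{1,T}^\top & Z_{1,T}Q\\ Q^\top Z_{1,T}^\top & Z_{0,T}Q\end{bmatrix}\succ0,\qquad \begin{bmatrix}I_T& Q\\ Q^\top& Z_{0,T}Q\end{bmatrix}\succ0$$ such that $\gamma<\alpha^2/(4+2\alpha)$ returns a stabilizing controller $K=U_{0,1,T}\,Q\,(Z_{0,T}Q)^{-1}$ for the system $x(k+1)=Ax(k)+Bu(k)$.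
   Context: Matrices: $U_{0,1,T}=[u_d(0)\ \cdots\ u_d(T-1)]$, $X_{0,T}=[x_d(0)\ \cdots\ x_d(T-1)]$, $X_{1,T}=[x_d(1)\ \cdots\ x_d(T)]$, $W_{0,T}=[w_d(0)\ \cdots\ w_d(T-1)]$, $W_{1,T}=[w_d(1)\ \cdots\ w_d(T)]$, $Z_{0,T}=X_{0,T}+W_{0,T}$, $Z_{1,T}=X_{1,T}+W_{1,T}$, and $R_{0,T}=AW_{0,T}-W_{1,T}$. $M\succ0$ means $M$ is symmetric and positive definite; $M\preceq N$ means $N-M$ is symmetric positive semidefinite. $K$ is a stabilizing controller if all eigenvalues of $A+BK$ have modulus strictly less than $1$. *)

theory Defs
  imports
    Complex_Main
    "Jordan_Normal_Form.Gauss_Jordan_Elimination"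
    "Jordan_Normal_Form.Char_Poly"
    "Jordan_Normal_Form.DL_Rank"
begin

(* The matrix [s(i) ... s(i+T-1)] whose columns are T consecutive samples of a
   d-dimensional signal. *)
definition data_mat :: "nat \<Rightarrow> (nat \<Rightarrow> real vec) \<Rightarrow> nat \<Rightarrow> nat \<Rightarrow> real mat" where
  "data_mat d s i T = mat_of_cols d (map s [i..<i + T])"

definition pos_def_mat :: "real mat \<Rightarrow> bool" where
  "pos_def_mat M \<longleftrightarrow> square_mat M \<and> transpose_mat M = M \<and>
     (\<forall>v \<in> carrier_vec (dim_row M). v \<noteq> 0\<^sub>v (dim_row M) \<longrightarrow> 0 < v \<bullet> (M *\<^sub>v v))"

definition pos_semidef_mat :: "real mat \<Rightarrow> bool" where
  "pos_semidef_mat M \<longleftrightarrow> square_mat M \<and> transpose_mat M = M \<and>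
     (\<forall>v \<in> carrier_vec (dim_row M). 0 \<le> v \<bullet> (M *\<^sub>v v))"

(* Subtraction takes its dimensions from the second operand, so loewner_le is
   meant for matrices of equal dimensions. *)
definition loewner_le :: "real mat \<Rightarrow> real mat \<Rightarrow> bool" where
  "loewner_le M N \<longleftrightarrow> pos_semidef_mat (N - M)"

(* The parameter of vec_space.rank is the dimension of the ambient space of the columns. *)
definition full_row_rank :: "real mat \<Rightarrow> bool" where
  "full_row_rank M \<longleftrightarrow> vec_space.rank (dim_row M) M = dim_row M"

primrec lti_state ::
  "real mat \<Rightarrow> real mat \<Rightarrow> real vec \<Rightarrow> (nat \<Rightarrow> real vec) \<Rightarrow> nat \<Rightarrow> real vec" where
  "lti_state A B x0 u 0 = x0"
| "lti_state A B x0 u (Suc k) = A *\<^sub>v lti_state A B x0 u k + B *\<^sub>v u k"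

(* Every state can be steered to every other state in finite time. *)
definition controllable :: "real mat \<Rightarrow> real mat \<Rightarrow> bool" where
  "controllable A B \<longleftrightarrow>
     (\<forall>x0 \<in> carrier_vec (dim_row A). \<forall>xf \<in> carrier_vec (dim_row A).
        \<exists>N u. (\<forall>k < N. u k \<in> carrier_vec (dim_col B)) \<and> lti_state A B x0 u N = xf)"

(* Eigenvalues are taken over the complex numbers. *)
definition stabilizing :: "real mat \<Rightarrow> real mat \<Rightarrow> real mat \<Rightarrow> bool" where
  "stabilizing A B K \<longleftrightarrow>
     (\<forall>z :: complex. eigenvalue (map_mat complex_of_real (A + B * K)) z \<longrightarrow> cmod z < 1)"

end

theory Submission
  imports Defs
begin

text \<open>Put \<open>P = Z0 Q\<close> and \<open>M = A + B K\<close>. Since \<open>Z1 = A Z0 + B U0 - R0\<close>, the closed loop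
  satisfies \<open>M P = (Z1 + R0) Q\<close>. Write \<open>G = Q P\<^sup>-\<^sup>1 Q\<^sup>T\<close>. The Schur complements of the two matrix
  inequalities are \<open>Z1 G Z1\<^sup>T \<prec> P - \<alpha> Z1 Z1\<^sup>T\<close> and \<open>G \<prec> I\<close>. Young's inequality with parameter
  \<open>\<alpha>/2\<close> then bounds \<open>M P M\<^sup>T = (Z1 + R0) G (Z1 + R0)\<^sup>T\<close> by
  \<open>Z1 G Z1\<^sup>T + (\<alpha>/2 + (1 + 2/\<alpha>) \<gamma>) Z1 Z1\<^sup>T\<close>, and \<open>\<gamma> < \<alpha>\<^sup>2/(4 + 2 \<alpha>)\<close> says exactly that the
  factor is below \<open>\<alpha>\<close>. Hence \<open>M P M\<^sup>T \<prec> P\<close>, a discrete Lyapunov inequality.\<close>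

section \<open>Matrix-vector algebra and expansion of symmetric forms\<close>

lemma mult_mat_vec_uminus:
  fixes v :: "'a :: ring vec"
  assumes "M \<in> carrier_mat n k" "v \<in> carrier_vec k"
  shows "M *\<^sub>v (- v) = - (M *\<^sub>v v)"
  using assms by (intro eq_vecI) auto

lemma mult_mat_vec_zero:
  fixes M :: "'a :: semiring_0 mat"
  assumes "M \<in> carrier_mat n k"
  shows "M *\<^sub>v 0\<^sub>v k = 0\<^sub>v n"
  using assms by (intro eq_vecI) auto

text \<open>General coefficients serve both uses: \<open>e\<close>, -1 and 1, 1 give Young's
  inequality, while the real and imaginary parts of an eigenvalue give the Lyapunov
  argument.\<close>

lemma sym_form_add_smult:
  fixes P :: "real mat"
  assumes P: "P \<in> carrier_mat n n" and sym: "transpose_mat P = P"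
    and a: "a \<in> carrier_vec n" and b: "b \<in> carrier_vec n"
  shows "(c \<cdot>\<^sub>v a + d \<cdot>\<^sub>v b) \<bullet> (P *\<^sub>v (c \<cdot>\<^sub>v a + d \<cdot>\<^sub>v b))
    = c\<^sup>2 * (a \<bullet> (P *\<^sub>v a)) + 2 * c * d * (a \<bullet> (P *\<^sub>v b)) + d\<^sup>2 * (b \<bullet> (P *\<^sub>v b))"
proof -
  have Pa: "P *\<^sub>v a \<in> carrier_vec n" and Pb: "P *\<^sub>v b \<in> carrier_vec n"
    using P a b by auto
  have "b \<bullet> (P *\<^sub>v a) = a \<bullet> (P *\<^sub>v b)"
    using transpose_vec_mult_scalar[OF P a b] comm_scalar_prod[OF a Pb] sym by simp
  moreover have "P *\<^sub>v (c \<cdot>\<^sub>v a + d \<cdot>\<^sub>v b) = c \<cdot>\<^sub>v (P *\<^sub>v a) + d \<cdot>\<^sub>v (P *\<^sub>v b)"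
    using P a b by (simp add: mult_add_distrib_mat_vec[of _ n n] mult_mat_vec[of _ n n])
  ultimately show ?thesis
    using a b Pa Pb
    by (simp add: add_scalar_prod_distrib[of _ n] scalar_prod_add_distrib[of _ n]
        smult_scalar_prod_distrib[of _ n] scalar_prod_smult_distrib[of _ n]
        power2_eq_square algebra_simps)
qed

section \<open>Positive definite matrices: Young's inequality, inverse, Schur complement\<close>

lemma pos_def_mat_form_nonneg:
  assumes "pos_def_mat P" "P \<in> carrier_mat n n" "v \<in> carrier_vec n"
  shows "0 \<le> v \<bullet> (P *\<^sub>v v)"
proof (cases "v = 0\<^sub>v n")
  case False
  then show ?thesis using assms unfolding pos_def_mat_def by force
qed (use assms in simp)

text \<open>The form is nonnegative at \<open>e\<close> times \<open>a\<close> minus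
  \<open>b\<close>; expanding there and dividing by \<open>e\<close> bounds the cross term.\<close>

lemma pos_def_mat_young:
  assumes pd: "pos_def_mat P" and P: "P \<in> carrier_mat n n"
    and a: "a \<in> carrier_vec n" and b: "b \<in> carrier_vec n" and e: "e > 0"
  shows "(a + b) \<bullet> (P *\<^sub>v (a + b))
    \<le> (1 + e) * (a \<bullet> (P *\<^sub>v a)) + (1 + 1 / e) * (b \<bullet> (P *\<^sub>v b))"
proof -
  have sym: "transpose_mat P = P" using pd by (simp add: pos_def_mat_def)
  note form = sym_form_add_smult[OF P sym a b]
  have "0 \<le> (e \<cdot>\<^sub>v a + (-1) \<cdot>\<^sub>v b) \<bullet> (P *\<^sub>v (e \<cdot>\<^sub>v a + (-1) \<cdot>\<^sub>v b))"
    using a b by (intro pos_def_mat_form_nonneg[OF pd P]) auto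
  then have "2 * e * (a \<bullet> (P *\<^sub>v b)) \<le> e\<^sup>2 * (a \<bullet> (P *\<^sub>v a)) + b \<bullet> (P *\<^sub>v b)"
    unfolding form by simp
  then have "2 * (a \<bullet> (P *\<^sub>v b)) \<le> e * (a \<bullet> (P *\<^sub>v a)) + (b \<bullet> (P *\<^sub>v b)) / e"
    using e by (simp add: field_simps power2_eq_square)
  then show ?thesis
    using form[of 1 1] by (simp add: algebra_simps)
qed

text \<open>A zero determinant would give a nonzero kernel vector, at which the form
  vanishes.\<close>

lemma pos_def_mat_invertible:
  assumes pd: "pos_def_mat P" and P: "P \<in> carrier_mat n n"
  obtains Pinv where "mat_inverse P = Some Pinv" "P * Pinv = 1\<^sub>m n" "Pinv * P = 1\<^sub>m n"
    "Pinv \<in> carrier_mat n n"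
proof -
  have "det P \<noteq> 0"
    using pd P unfolding det_0_iff_vec_prod_zero[OF P] pos_def_mat_def
    by auto
  then have "P \<in> Units (ring_mat TYPE(real) n ())"
    by (rule det_non_zero_imp_unit[OF P])
  then have "mat_inverse P \<noteq> None" using mat_inverse(1)[OF P, of "()"] by blast
  then show ?thesis using that mat_inverse(2)[OF P] by blast
qed

text \<open>Vectors whose upper part is zero see only the lower right block.\<close>

lemma pos_def_mat_four_block_lower:
  assumes A: "A \<in> carrier_mat n n" and B: "B \<in> carrier_mat n k"
    and C: "C \<in> carrier_mat k n" and D: "D \<in> carrier_mat k k"
    and pd: "pos_def_mat (four_block_mat A B C D)"
  shows "pos_def_mat D"
proof -
  let ?M = "four_block_mat A B C D"
  have M: "?M \<in> carrier_mat (n + k) (n + k)" using A D by auto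
  have symM: "transpose_mat ?M = ?M" using pd by (simp add: pos_def_mat_def)
  have "transpose_mat D = D"
  proof (intro eq_matI)
    fix i j assume ij: "i < dim_row D" "j < dim_col D"
    have "transpose_mat ?M $$ (n + i, n + j) = ?M $$ (n + i, n + j)" by (simp only: symM)
    then show "transpose_mat D $$ (i, j) = D $$ (i, j)" using ij A D by simp
  qed (use D in auto)
  moreover have "0 < y \<bullet> (D *\<^sub>v y)" if y: "y \<in> carrier_vec k" and y0: "y \<noteq> 0\<^sub>v k" for y
  proof -
    let ?v = "0\<^sub>v n @\<^sub>v y"
    have "?v \<noteq> 0\<^sub>v (n + k)"
    proof
      assume "?v = 0\<^sub>v (n + k)"
      also have "\<dots> = 0\<^sub>v n @\<^sub>v 0\<^sub>v k" by (intro eq_vecI) auto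
      finally show False using y0 by (simp add: append_vec_eq[of _ n])
    qed
    then have "0 < ?v \<bullet> (?M *\<^sub>v ?v)"
      using pd M y unfolding pos_def_mat_def by auto
    also have "?v \<bullet> (?M *\<^sub>v ?v) = y \<bullet> (D *\<^sub>v y)"
      using A B C D y mult_mat_vec_zero[OF A] mult_mat_vec_zero[OF C]
      by (simp add: four_block_mat_mult_vec[OF A B C D] scalar_prod_append[of _ n _ k])
    finally show ?thesis .
  qed
  ultimately show ?thesis using D by (auto simp: pos_def_mat_def)
qed

text \<open>The left side is the form of \<open>B * Di * transpose_mat B\<close> at
  \<open>v\<close>, written through \<open>D\<close> so that it is a value of the form of
  \<open>D\<close>. The test vector is \<open>v\<close> above \<open>- y\<close> with
  \<open>y = Di *\<^sub>v (transpose_mat B *\<^sub>v v)\<close>: this choice makes the lower half of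
  the image vanish.\<close>

lemma pos_def_mat_schur:
  assumes A: "A \<in> carrier_mat n n" and B: "B \<in> carrier_mat n k"
    and D: "D \<in> carrier_mat k k" and Di: "Di \<in> carrier_mat k k" and inv: "D * Di = 1\<^sub>m k"
    and pd: "pos_def_mat (four_block_mat A B (transpose_mat B) D)"
    and v: "v \<in> carrier_vec n" and v0: "v \<noteq> 0\<^sub>v n"
  shows "(Di *\<^sub>v (transpose_mat B *\<^sub>v v)) \<bullet> (D *\<^sub>v (Di *\<^sub>v (transpose_mat B *\<^sub>v v)))
    < v \<bullet> (A *\<^sub>v v)"
proof -
  let ?M = "four_block_mat A B (transpose_mat B) D"
  define b where "b = transpose_mat B *\<^sub>v v"
  define y where "y = Di *\<^sub>v b"
  have M: "?M \<in> carrier_mat (n + k) (n + k)" using A D by auto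
  have BT: "transpose_mat B \<in> carrier_mat k n" using B by simp
  have b: "b \<in> carrier_vec k" and y: "y \<in> carrier_vec k"
    using BT Di v by (auto simp: b_def y_def)
  have Dy: "D *\<^sub>v y = b"
    using D Di b inv by (simp add: y_def flip: assoc_mult_mat_vec)
  let ?v = "v @\<^sub>v (- y)"
  have "?v \<noteq> 0\<^sub>v (n + k)"
  proof
    assume "?v = 0\<^sub>v (n + k)"
    also have "\<dots> = 0\<^sub>v n @\<^sub>v 0\<^sub>v k" by (intro eq_vecI) auto
    finally show False using v v0 by (simp add: append_vec_eq[of _ n])
  qed
  then have "0 < ?v \<bullet> (?M *\<^sub>v ?v)"
    using pd M v y unfolding pos_def_mat_def by auto
  also have "?M *\<^sub>v ?v = (A *\<^sub>v v + B *\<^sub>v (- y)) @\<^sub>v (b + D *\<^sub>v (- y))"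
    using four_block_mat_mult_vec[OF A B BT D v, of "- y"] y by (simp add: b_def)
  also have "B *\<^sub>v (- y) = - (B *\<^sub>v y)" by (rule mult_mat_vec_uminus[OF B y])
  also have "b + D *\<^sub>v (- y) = 0\<^sub>v k"
    using mult_mat_vec_uminus[OF D y] Dy b by simp
  also have "?v \<bullet> ((A *\<^sub>v v + - (B *\<^sub>v y)) @\<^sub>v 0\<^sub>v k) = v \<bullet> (A *\<^sub>v v) - v \<bullet> (B *\<^sub>v y)"
    using A B v y
    by (simp add: scalar_prod_append[of _ n _ k] scalar_prod_add_distrib[of _ n])
  also have "v \<bullet> (B *\<^sub>v y) = b \<bullet> y"
    using transpose_vec_mult_scalar[OF B y v] by (simp add: b_def)
  also have "\<dots> = y \<bullet> (D *\<^sub>v y)"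
    using comm_scalar_prod[OF b y] Dy by simp
  finally show ?thesis by (simp add: y_def b_def)
qed

section \<open>Evaluation of forms and the discrete Lyapunov criterion\<close>

lemma gram_form:
  fixes Z :: "real mat"
  assumes Z: "Z \<in> carrier_mat n k" and v: "v \<in> carrier_vec n"
  shows "v \<bullet> ((Z * transpose_mat Z) *\<^sub>v v) = (transpose_mat Z *\<^sub>v v) \<bullet> (transpose_mat Z *\<^sub>v v)"
  using transpose_vec_mult_scalar[OF Z _ v, of "transpose_mat Z *\<^sub>v v"] Z v by auto

lemma smult_mat_form:
  fixes M :: "real mat"
  assumes "M \<in> carrier_mat n n" "v \<in> carrier_vec n"
  shows "v \<bullet> ((c \<cdot>\<^sub>m M) *\<^sub>v v) = c * (v \<bullet> (M *\<^sub>v v))"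
proof -
  have "(c \<cdot>\<^sub>m M) *\<^sub>v v = c \<cdot>\<^sub>v (M *\<^sub>v v)"
    using assms by (intro eq_vecI) auto
  then show ?thesis using assms by simp
qed

lemma minus_mat_form:
  fixes M N :: "real mat"
  assumes "M \<in> carrier_mat n n" "N \<in> carrier_mat n n" "v \<in> carrier_vec n"
  shows "v \<bullet> ((M - N) *\<^sub>v v) = v \<bullet> (M *\<^sub>v v) - v \<bullet> (N *\<^sub>v v)"
  using assms
  by (simp add: minus_mult_distrib_mat_vec[of _ n n] scalar_prod_minus_distrib[of _ n])

text \<open>For a left eigenvector \<open>p + i q\<close>, the form of \<open>P\<close>, summed over \<open>p\<close> and \<open>q\<close>, is
  scaled by \<open>|z|\<^sup>2\<close> under the transpose of \<open>M\<close>.\<close>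

lemma discrete_lyapunov:
  fixes M P :: "real mat"
  assumes M: "M \<in> carrier_mat n n" and P: "P \<in> carrier_mat n n" and pd: "pos_def_mat P"
    and decr: "\<And>v. v \<in> carrier_vec n \<Longrightarrow> v \<noteq> 0\<^sub>v n \<Longrightarrow>
      (transpose_mat M *\<^sub>v v) \<bullet> (P *\<^sub>v (transpose_mat M *\<^sub>v v)) < v \<bullet> (P *\<^sub>v v)"
    and ev: "eigenvalue (map_mat complex_of_real M) z"
  shows "cmod z < 1"
proof -
  let ?C = "map_mat complex_of_real M" and ?N = "transpose_mat M"
  have C: "?C \<in> carrier_mat n n" and CT: "transpose_mat ?C \<in> carrier_mat n n"
    and N: "?N \<in> carrier_mat n n"
    using M by auto
  have sym: "transpose_mat P = P" using pd by (simp add: pos_def_mat_def)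
  \<comment> \<open>A matrix and its transpose share the characteristic polynomial. The passage is
    needed because \<open>decr\<close> concerns the transpose of \<open>M\<close>.\<close>
  have "eigenvalue (transpose_mat ?C) z"
    using ev C CT by (simp add: eigenvalue_root_char_poly[of _ n])
  then obtain v where v: "v \<in> carrier_vec n" and v0: "v \<noteq> 0\<^sub>v n"
    and eq: "transpose_mat ?C *\<^sub>v v = z \<cdot>\<^sub>v v"
    using CT M unfolding eigenvalue_def eigenvector_def by auto
  define p q where "p = map_vec Re v" and "q = map_vec Im v"
  have p: "p \<in> carrier_vec n" and q: "q \<in> carrier_vec n"
    using v by (auto simp: p_def q_def)
  have entry: "(\<Sum>j<n. complex_of_real (M $$ (j, i)) * v $ j) = z * v $ i" if "i < n" for i
  proof -
    have "(transpose_mat ?C *\<^sub>v v) $ i = (\<Sum>j<n. complex_of_real (M $$ (j, i)) * v $ j)"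
      using M v that by (auto simp: scalar_prod_def lessThan_atLeast0 intro!: sum.cong)
    then show ?thesis using eq v that by simp
  qed
  \<comment> \<open>Since \<open>M\<close> is real, the real and imaginary parts of the eigenvector
    equation separate: on \<open>p\<close> and \<open>q\<close> the transpose acts as a rotation
    scaled by |z|.\<close>
  have Np: "?N *\<^sub>v p = Re z \<cdot>\<^sub>v p + (- Im z) \<cdot>\<^sub>v q"
  proof (intro eq_vecI)
    fix i assume "i < dim_vec (Re z \<cdot>\<^sub>v p + (- Im z) \<cdot>\<^sub>v q)"
    then have i: "i < n" using q by simp
    have "(?N *\<^sub>v p) $ i = (\<Sum>j<n. M $$ (j, i) * Re (v $ j))"
      using M v i by (auto simp: p_def scalar_prod_def lessThan_atLeast0 intro!: sum.cong)
    also have "\<dots> = Re (z * v $ i)" unfolding entry[OF i, symmetric] by simp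
    finally show "(?N *\<^sub>v p) $ i = (Re z \<cdot>\<^sub>v p + (- Im z) \<cdot>\<^sub>v q) $ i"
      using i v by (simp add: p_def q_def)
  qed (use M q in auto)
  have Nq: "?N *\<^sub>v q = Im z \<cdot>\<^sub>v p + Re z \<cdot>\<^sub>v q"
  proof (intro eq_vecI)
    fix i assume "i < dim_vec (Im z \<cdot>\<^sub>v p + Re z \<cdot>\<^sub>v q)"
    then have i: "i < n" using q by simp
    have "(?N *\<^sub>v q) $ i = (\<Sum>j<n. M $$ (j, i) * Im (v $ j))"
      using M v i by (auto simp: q_def scalar_prod_def lessThan_atLeast0 intro!: sum.cong)
    also have "\<dots> = Im (z * v $ i)" unfolding entry[OF i, symmetric] by simp
    finally show "(?N *\<^sub>v q) $ i = (Im z \<cdot>\<^sub>v p + Re z \<cdot>\<^sub>v q) $ i"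
      using i v by (simp add: p_def q_def)
  qed (use M q in auto)
  define f where "f a = a \<bullet> (P *\<^sub>v a)" for a
  have f_pos: "0 < f a" if "a \<in> carrier_vec n" "a \<noteq> 0\<^sub>v n" for a
    using that pd P unfolding f_def pos_def_mat_def by auto
  have f0: "f (0\<^sub>v n) = 0" and fN0: "f (?N *\<^sub>v 0\<^sub>v n) = 0"
    using P by (simp_all add: f_def mult_mat_vec_zero[OF P] mult_mat_vec_zero[OF N])
  have pq: "p \<noteq> 0\<^sub>v n \<or> q \<noteq> 0\<^sub>v n"
  proof (rule ccontr)
    assume "\<not> ?thesis"
    then have "p $ i = 0 \<and> q $ i = 0" if "i < n" for i using that by simp
    then have "v = 0\<^sub>v n"
      using v by (intro eq_vecI) (auto simp: p_def q_def complex_eq_iff)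
    then show False using v0 by simp
  qed
  \<comment> \<open>One of \<open>p\<close> and \<open>q\<close> may be zero. The strict decrease is
    applied to a nonzero one, this weak form to the other.\<close>
  have le: "f (?N *\<^sub>v a) \<le> f a" "0 \<le> f a" if "a \<in> carrier_vec n" for a
    using decr[OF that] f_pos[OF that] f0 fN0 unfolding f_def by (cases "a = 0\<^sub>v n"; force)+
  have "f (?N *\<^sub>v p) + f (?N *\<^sub>v q) < f p + f q"
    using pq le(1)[OF p] le(1)[OF q] decr[OF p] decr[OF q] unfolding f_def by linarith
  \<comment> \<open>The mixed terms have coefficients -2 Re z Im z and 2 Re z Im z, so they cancel
    in the sum.\<close>
  moreover have "f (?N *\<^sub>v p) + f (?N *\<^sub>v q) = (cmod z)\<^sup>2 * (f p + f q)"
    unfolding Np Nq f_def sym_form_add_smult[OF P sym p q] cmod_power2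
    by (simp add: algebra_simps)
  moreover have "0 < f p + f q"
    using pq f_pos p q le(2) by (meson add_pos_nonneg add_nonneg_pos)
  ultimately have "(cmod z)\<^sup>2 < 1" by simp
  then show ?thesis by (simp add: power_less_one_iff abs_square_less_1)
qed

section \<open>Data matrices and the system equation\<close>

lemma data_mat_carrier: "data_mat d s i T \<in> carrier_mat d T"
  using mat_of_cols_carrier(1)[of d "map s [i..<i + T]"] by (simp add: data_mat_def)

lemma data_mat_dynamics:
  assumes A: "A \<in> carrier_mat n n" and B: "B \<in> carrier_mat n m"
    and u: "\<And>k. k < T \<Longrightarrow> u k \<in> carrier_vec m"
    and x: "\<And>k. k \<le> T \<Longrightarrow> x k \<in> carrier_vec n"
    and dyn: "\<And>k. k < T \<Longrightarrow> x (k + 1) = A *\<^sub>v x k + B *\<^sub>v u k"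
  shows "data_mat n x 1 T = A * data_mat n x 0 T + B * data_mat m u 0 T"
proof (intro eq_matI)
  fix i j
  assume "i < dim_row (A * data_mat n x 0 T + B * data_mat m u 0 T)"
    and "j < dim_col (A * data_mat n x 0 T + B * data_mat m u 0 T)"
  then have i: "i < n" and j: "j < T" using B by (auto simp: data_mat_def)
  have cx: "col (data_mat n x 0 T) j = x j" and cu: "col (data_mat m u 0 T) j = u j"
    using x[of j] u[of j] j by (auto simp: data_mat_def)
  \<comment> \<open>The samples start at index 1, so column \<open>j\<close> holds
    \<open>x (j + 1)\<close>. Without \<open>upt_Suc\<close> the index list stays an interval and
    its entries can be read off directly.\<close>
  have "data_mat n x 1 T $$ (i, j) = x (j + 1) $ i"
    using i j by (simp add: data_mat_def mat_of_cols_index del: upt_Suc)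
  also have "\<dots> = (A * data_mat n x 0 T + B * data_mat m u 0 T) $$ (i, j)"
    unfolding dyn[OF j] using A B i j cx cu data_mat_carrier[of n x 0 T]
      data_mat_carrier[of m u 0 T] by simp
  finally show "data_mat n x 1 T $$ (i, j) = (A * data_mat n x 0 T + B * data_mat m u 0 T) $$ (i, j)" .
qed (use A B in \<open>auto simp: data_mat_def\<close>)

section \<open>Closed-loop stability from noisy data\<close>

theorem theorem5:
  fixes n m T :: nat
    and A B Q U0 X0 X1 W0 W1 Z0 Z1 R0 :: "real mat"
    and u x w :: "nat \<Rightarrow> real vec"
    and \<gamma> \<alpha> :: real
  assumes A: "A \<in> carrier_mat n n"
    and B: "B \<in> carrier_mat n m"
    and ctrb: "controllable A B"
    and u: "\<And>k. k < T \<Longrightarrow> u k \<in> carrier_vec m"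
    and x: "\<And>k. k \<le> T \<Longrightarrow> x k \<in> carrier_vec n"
    and w: "\<And>k. k \<le> T \<Longrightarrow> w k \<in> carrier_vec n"
    and dyn: "\<And>k. k < T \<Longrightarrow> x (k + 1) = A *\<^sub>v x k + B *\<^sub>v u k"
    and U0: "U0 = data_mat m u 0 T"
    and X0: "X0 = data_mat n x 0 T"
    and X1: "X1 = data_mat n x 1 T"
    and W0: "W0 = data_mat n w 0 T"
    and W1: "W1 = data_mat n w 1 T"
    and Z0: "Z0 = X0 + W0"
    and Z1: "Z1 = X1 + W1"
    and R0: "R0 = A * W0 - W1"
    and rank_UZ: "full_row_rank (U0 @\<^sub>r Z0)"
    and rank_Z1: "full_row_rank Z1"
    and \<gamma>_pos: "\<gamma> > 0"
    and noise: "loewner_le (R0 * transpose_mat R0) (\<gamma> \<cdot>\<^sub>m (Z1 * transpose_mat Z1))"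
    and Q: "Q \<in> carrier_mat T n"
    and \<alpha>_pos: "\<alpha> > 0"
    and lmi1: "pos_def_mat (four_block_mat
                 (Z0 * Q - \<alpha> \<cdot>\<^sub>m (Z1 * transpose_mat Z1)) (Z1 * Q)
                 (transpose_mat Q * transpose_mat Z1)       (Z0 * Q))"
    and lmi2: "pos_def_mat (four_block_mat
                 (1\<^sub>m T)           Q
                 (transpose_mat Q) (Z0 * Q))"
    and \<gamma>_small: "\<gamma> < \<alpha>\<^sup>2 / (4 + 2 * \<alpha>)"
  shows "stabilizing A B (U0 * Q * the (mat_inverse (Z0 * Q)))"
proof -
  define P where "P = Z0 * Q"
  have cU: "U0 \<in> carrier_mat m T" and cX0: "X0 \<in> carrier_mat n T" and cW0: "W0 \<in> carrier_mat n T"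
    and cX1: "X1 \<in> carrier_mat n T" and cW1: "W1 \<in> carrier_mat n T"
    using data_mat_carrier unfolding U0 X0 X1 W0 W1 by auto
  have cZ0: "Z0 \<in> carrier_mat n T" and cZ1: "Z1 \<in> carrier_mat n T" and cR: "R0 \<in> carrier_mat n T"
    unfolding Z0 Z1 R0 using cX0 cX1 cW0 cW1 A by auto
  have cP: "P \<in> carrier_mat n n" unfolding P_def using cZ0 Q by auto
  have cQT: "transpose_mat Q \<in> carrier_mat n T" using Q by simp
  \<comment> \<open>Symmetry of \<open>Z0 * Q\<close> is not assumed separately: it comes with the
    lower right block of the second matrix inequality.\<close>
  have pdP: "pos_def_mat P"
    using pos_def_mat_four_block_lower[OF one_carrier_mat Q cQT cP] lmi2 by (simp add: P_def)
  then have symP: "transpose_mat P = P" by (simp add: pos_def_mat_def)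
  obtain Pi where inv: "mat_inverse P = Some Pi" and PPi: "P * Pi = 1\<^sub>m n"
    and PiP: "Pi * P = 1\<^sub>m n" and cPi: "Pi \<in> carrier_mat n n"
    using pos_def_mat_invertible[OF pdP cP] .
  \<comment> \<open>Because \<open>P\<close> is symmetric, the transpose of its right inverse is a
    left inverse, hence equals \<open>Pi\<close>. This turns the transpose of \<open>Q * Pi\<close>
    into \<open>Pi * transpose_mat Q\<close>.\<close>
  have symPi: "transpose_mat Pi = Pi"
  proof -
    have PT: "transpose_mat Pi * P = 1\<^sub>m n"
      using transpose_mult[OF cP cPi] PPi symP by simp
    have "transpose_mat Pi = transpose_mat Pi * (P * Pi)" using PPi cPi by simp
    also have "\<dots> = (transpose_mat Pi * P) * Pi"
      using cP cPi by (subst assoc_mult_mat[of _ n n _ n _ n]) auto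
    finally show ?thesis using PT cPi by simp
  qed
  define K where "K = U0 * Q * Pi"
  define M where "M = A + B * K"
  have cK: "K \<in> carrier_mat m n" unfolding K_def using cU Q cPi by auto
  have cM: "M \<in> carrier_mat n n" unfolding M_def using A B cK by auto
  \<comment> \<open>The noise in \<open>Z0\<close> contributes \<open>A * W0\<close>; trading
    \<open>X1\<close> for \<open>Z1\<close> subtracts \<open>W1\<close>. Together they are
    \<open>R0\<close>.\<close>
  have data: "A * Z0 + B * U0 = Z1 + R0"
  proof -
    have X1eq: "X1 = A * X0 + B * U0"
      unfolding X1 X0 U0 by (rule data_mat_dynamics[OF A B]) (fact u x dyn)+
    have "A * Z0 = A * X0 + A * W0"
      unfolding Z0 by (rule mult_add_distrib_mat[OF A cX0 cW0])
    then show ?thesis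
      unfolding Z1 R0 X1eq using A B cU cX0 cW0 cW1 by (intro eq_matI) auto
  qed
  \<comment> \<open>The factor \<open>Q * Pi\<close> is a right inverse of \<open>Z0\<close> and is
    sent to \<open>K\<close> by \<open>U0\<close>, so multiplying the data equation by it yields
    \<open>A + B * K\<close>.\<close>
  have closed_loop: "M = (Z1 + R0) * (Q * Pi)"
  proof -
    have QPi: "Q * Pi \<in> carrier_mat T n" using Q cPi by simp
    have "(Z1 + R0) * (Q * Pi) = A * Z0 * (Q * Pi) + B * U0 * (Q * Pi)"
      unfolding data[symmetric] using A B cU cZ0 QPi
      by (intro add_mult_distrib_mat[of _ n T]) auto
    also have "A * Z0 * (Q * Pi) = A * (Z0 * Q * Pi)"
      using A cZ0 Q cPi QPi by (simp add: assoc_mult_mat[of _ n n _ T _ n] assoc_mult_mat[of _ n T _ n _ n])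
    also have "\<dots> = A" using PPi A by (simp add: P_def)
    also have "B * U0 * (Q * Pi) = B * K"
      using B cU Q cPi QPi by (simp add: K_def assoc_mult_mat[of _ n m _ T _ n] assoc_mult_mat[of _ m T _ n _ n])
    finally show ?thesis by (simp add: M_def)
  qed
  \<comment> \<open>With these abbreviations \<open>f (y s)\<close> is the form of G =
    \<open>Q * Pi * transpose_mat Q\<close> at \<open>s\<close>.\<close>
  define y where "y s = Pi *\<^sub>v (transpose_mat Q *\<^sub>v s)" for s
  define f where "f a = a \<bullet> (P *\<^sub>v a)" for a
  have cy: "y s \<in> carrier_vec n" if "s \<in> carrier_vec T" for s
    unfolding y_def using that cPi cQT by simp
  \<comment> \<open>This is the Schur complement of the second inequality, weakened to include the
    zero vector, since \<open>a\<close> or \<open>b\<close> below may vanish.\<close>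
  have f_le: "f (y s) \<le> s \<bullet> s" if s: "s \<in> carrier_vec T" for s
  proof (cases "s = 0\<^sub>v T")
    case True
    have "y s = 0\<^sub>v n" unfolding y_def True
      by (simp add: mult_mat_vec_zero[OF cQT] mult_mat_vec_zero[OF cPi])
    then show ?thesis using True cP by (simp add: f_def)
  next
    case False
    show ?thesis
      using pos_def_mat_schur[OF one_carrier_mat Q cP cPi PPi _ s False] lmi2 s
      by (simp add: P_def f_def y_def)
  qed
  have "(transpose_mat M *\<^sub>v v) \<bullet> (P *\<^sub>v (transpose_mat M *\<^sub>v v)) < v \<bullet> (P *\<^sub>v v)"
    if v: "v \<in> carrier_vec n" and v0: "v \<noteq> 0\<^sub>v n" for v
  proof -
    define a b where "a = transpose_mat Z1 *\<^sub>v v" and "b = transpose_mat R0 *\<^sub>v v"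
    have ca: "a \<in> carrier_vec T" and cb: "b \<in> carrier_vec T"
      using cZ1 cR v by (auto simp: a_def b_def)
    have Mv: "transpose_mat M *\<^sub>v v = y a + y b"
    proof -
      have "transpose_mat M = Pi * transpose_mat Q * (transpose_mat Z1 + transpose_mat R0)"
        unfolding closed_loop
        using transpose_mult[of "Z1 + R0" n T "Q * Pi" n] transpose_mult[OF Q cPi]
          transpose_add[OF cZ1 cR] symPi cZ1 cR Q cPi by simp
      moreover have "(transpose_mat Z1 + transpose_mat R0) *\<^sub>v v = a + b"
        unfolding a_def b_def using cZ1 cR v by (intro add_mult_distrib_mat_vec[of _ T n]) auto
      ultimately have "transpose_mat M *\<^sub>v v = Pi *\<^sub>v (transpose_mat Q *\<^sub>v (a + b))"
        using cPi cQT cZ1 cR v ca cb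
        by (simp add: assoc_mult_mat_vec[of _ n T _ n] assoc_mult_mat_vec[of _ n n _ T])
      also have "\<dots> = y a + y b"
        unfolding y_def using ca cb cQT cPi
        by (simp add: mult_add_distrib_mat_vec[OF cQT] mult_add_distrib_mat_vec[OF cPi])
      finally show ?thesis .
    qed
    have cZZ: "Z1 * transpose_mat Z1 \<in> carrier_mat n n" and cRR: "R0 * transpose_mat R0 \<in> carrier_mat n n"
      using cZ1 cR by auto
    \<comment> \<open>The noise hypothesis, evaluated at \<open>v\<close> through the Gram
      matrices.\<close>
    have b_le: "b \<bullet> b \<le> \<gamma> * (a \<bullet> a)"
    proof -
      have "0 \<le> v \<bullet> ((\<gamma> \<cdot>\<^sub>m (Z1 * transpose_mat Z1) - R0 * transpose_mat R0) *\<^sub>v v)"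
        using noise v cR unfolding loewner_le_def pos_semidef_mat_def by simp
      also have "\<dots> = \<gamma> * (v \<bullet> ((Z1 * transpose_mat Z1) *\<^sub>v v)) - v \<bullet> ((R0 * transpose_mat R0) *\<^sub>v v)"
        using minus_mat_form[OF _ cRR v] smult_mat_form[OF cZZ v] cZZ by (metis smult_carrier_mat)
      finally show ?thesis
        unfolding gram_form[OF cZ1 v] gram_form[OF cR v] a_def b_def by simp
    qed
    \<comment> \<open>The Schur complement of the first inequality at \<open>v\<close>; it leaves a
      margin of \<alpha> times the squared norm of \<open>a\<close>.\<close>
    have fa: "f (y a) < f v - \<alpha> * (a \<bullet> a)"
    proof -
      have cZQ: "Z1 * Q \<in> carrier_mat n n" using cZ1 Q by simp
      have ZQT: "transpose_mat (Z1 * Q) = transpose_mat Q * transpose_mat Z1"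
        by (rule transpose_mult[OF cZ1 Q])
      have cL: "P - \<alpha> \<cdot>\<^sub>m (Z1 * transpose_mat Z1) \<in> carrier_mat n n" using cZZ by (intro minus_carrier_mat) simp
      have "y a = Pi *\<^sub>v (transpose_mat (Z1 * Q) *\<^sub>v v)"
        unfolding ZQT y_def a_def using cQT cZ1 v by (simp add: assoc_mult_mat_vec[of _ n T _ n])
      then have "f (y a) < v \<bullet> ((P - \<alpha> \<cdot>\<^sub>m (Z1 * transpose_mat Z1)) *\<^sub>v v)"
        using pos_def_mat_schur[OF cL cZQ cP cPi PPi _ v v0] lmi1 by (simp add: ZQT P_def f_def)
      also have "\<dots> = f v - \<alpha> * (a \<bullet> a)"
        unfolding minus_mat_form[OF cP smult_carrier_mat[OF cZZ] v] smult_mat_form[OF cZZ v]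
          gram_form[OF cZ1 v] f_def a_def ..
      finally show ?thesis .
    qed
    have aa: "0 \<le> a \<bullet> a" by (simp add: scalar_prod_def sum_nonneg)
    \<comment> \<open>Dividing \<gamma> (4 + 2 \<alpha>) < \<open>\<alpha>\<^sup>2\<close> by 2
      \<alpha> gives this bound.\<close>
    have factor: "(1 + 2 / \<alpha>) * \<gamma> \<le> \<alpha> / 2"
    proof -
      have "\<gamma> * (4 + 2 * \<alpha>) < \<alpha>\<^sup>2"
        using \<gamma>_small \<alpha>_pos by (simp add: pos_less_divide_eq)
      then show ?thesis using \<alpha>_pos by (simp add: field_simps power2_eq_square)
    qed
    \<comment> \<open>Young's parameter \<alpha>/2 spends half of the margin on the excess of
      \<open>f (y a)\<close> and leaves the other half for the noise term.\<close>
    have "f (y a + y b) \<le> (1 + \<alpha> / 2) * f (y a) + (1 + 1 / (\<alpha> / 2)) * f (y b)"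
      unfolding f_def using \<alpha>_pos
      by (intro pos_def_mat_young[OF pdP cP cy[OF ca] cy[OF cb]]) simp
    \<comment> \<open>Only the excess \<alpha>/2 of \<open>f (y a)\<close> is estimated by
      \<open>f_le\<close>; one full copy is kept for the sharper bound \<open>fa\<close>.\<close>
    also have "\<dots> \<le> f (y a) + \<alpha> / 2 * (a \<bullet> a) + (1 + 2 / \<alpha>) * (\<gamma> * (a \<bullet> a))"
    proof -
      have "\<alpha> / 2 * f (y a) \<le> \<alpha> / 2 * (a \<bullet> a)"
        using f_le[OF ca] \<alpha>_pos by (intro mult_left_mono) auto
      moreover have "(1 + 2 / \<alpha>) * f (y b) \<le> (1 + 2 / \<alpha>) * (\<gamma> * (a \<bullet> a))"
        using f_le[OF cb] b_le \<alpha>_pos by (intro mult_left_mono) auto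
      ultimately show ?thesis by (simp add: algebra_simps)
    qed
    also have "\<dots> \<le> f (y a) + \<alpha> * (a \<bullet> a)"
      using mult_right_mono[OF factor aa] by (simp add: mult.assoc)
    also have "\<dots> < f v" using fa by simp
    finally show ?thesis unfolding Mv f_def .
  qed
  then have "cmod z < 1" if "eigenvalue (map_mat complex_of_real M) z" for z
    using discrete_lyapunov[OF cM cP pdP] that by blast
  then show ?thesis
    using inv unfolding stabilizing_def M_def K_def P_def by simp
qed

end
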